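(* Let $R=(u_1^R,u_2^R)$ be a fixed state in $\mathcal D$, and consider a wave curve through (starting at) $R$, forward or backward. Select a coordinate $i\in\{1,2\}$ (say $i=1$) such that the wave curve can be parametrized by $\ell=u_i$, i.e. as $\Gamma=(\gamma_1,\gamma_2):I\to\mathcal D$ with $I\subset\mathbb R$ an interval, $\gamma_i(\ell)=\ell$ for all $\ell\in I$, and $\Gamma(u_i^R)=R$. Then the respective flux function along $\Gamma$, $$\mathfrak f: I\to\mathbb R,\qquad \ell\mapsto \mathfrak f(\ell)=f_i\big(\Gamma(\ell)\big),$$ is an effective flux function (EFF) for the wave curve $\Gamma$ based at $R$ in the coordinate $u_i$.
   Context: Setting. $\mathcal D\subset\mathbb R^2$ is the space of states $U=(u_1,u_2)$, and $F=(f_1,f_2):\mathcal D\to\mathbb R^2$ is a continuously differentiable flux for the system of conservation laws $\partial_t U+\partial_x F(U)=0$. $\mathrm J(U)=\partial F/\partial U$ is its Jacobian matrix, with eigenvalues $\lambda_{s}(U)\le\lambda_{f}(U)$ (slow and fast families) that are real at the states considered. The system is not assumed to be strictly hyperbolic everywhere. For $k\in\{s,f\}$, $\vec r_k(U)$ is an eigenvector of $\mathrm J(U)$ for $\lambda_k(U)$. Rankine-Hugoniot locus. $\mathcal H(R)$ is the set of states $U$ for which there is $\sigma=\sigma(R,U)\in\mathbb R$ (the shock speed) with $F(U)-\sigma U=F(R)-\sigma R$, both components holding. For $U=R$ any value may be assigned to $\sigma$. Integral curves. $\mathcal R_k(U^o)$ is the curve through $U^o$ everywhere tangent to $\vec r_k$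 ($k$-rarefaction curve). Shock admissibility. A discontinuity with left state $U^L$, right state $U^R$ and speed $\sigma$ is a slow-family shock if $\lambda_s(U^R)<\sigma<\lambda_s(U^L)$ and $\sigma<\lambda_f(U^R)$, and a fast-family shock if $\lambda_f(U^R)<\sigma<\lambda_f(U^L)$ and $\lambda_s(U^L)<\sigma$; one of the inequalities is allowed to become an equality. It must also satisfy Liu's admissibility criterion, whenever applicable, along the part of the Hugoniot locus between the two states. Wave curve through $R$. It is a curve starting at $R$ made of finitely many consecutive segments, each being one of the following. (S) A shock segment: a curve of states $U\in\mathcal H(R)$ such that the discontinuity between $R$ and $U$ is admissible ($R$ is the left state in the forward construction and the right state in the backward construction). The reference state is always the original state $R$, also when the segment follows a rarefaction segment. (R) A $k$-rarefaction segment with starting state $U^o$: an arc of $\mathcal R_k(U^o)$ beginning at $U^o$, along which $\lambda_k$ is increasing (forward construction) or decreasing (backward construction). Here $U^o=R$ if it is the first segment; otherwise $U^o$ is the end state of the preceding shock segment. The family $k$ may differ from segment to segment. A transition from a shock segment to a $k$-rarefaction segment occurs at a state $U^*\in\mathcal H(R)$ with $\sigma(R,U^* )=\lambda_{k}(U^* )$ (a Bethe-Wendroff point). A transition from a $k$-rarefaction segment to a shock segment occurs at a state $U^*$ on the rarefaction curve that also belongs to $\mathcal H(R)$, with $\sigma(R,U^* )=\lambda_k(U^* )$. The parametrization $\Gamma$ is continuous, and is continuously differentiable on each rarefaction segment, with $\Gamma'(\ell)$ parallel to $\vec r_k(\Gamma(\ell))$ there. Effective flux function (EFF), or lifting. Given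 the wave curve $\Gamma:I\to\mathcal D$ through $R$ parametrized by $\ell=u_i$, an EFF is a function $\mathfrak f:I\to\mathbb R$ such that: (1) for every $\ell$ in the (closed) subinterval corresponding to a shock segment, $\mathfrak f(\ell)=f_i(R)+\sigma\big(R,\Gamma(\ell)\big)\,(\ell-u_i^R)$ (at $\ell=u_i^R$ this reads $\mathfrak f(u_i^R)=f_i(R)$); (2) for every $\ell$ in the (closed) subinterval corresponding to a $k$-rarefaction segment with starting state $U^o=\Gamma(\ell^o)$, $\mathfrak f(\ell)=f_i(U^o)+\int_{\ell^o}^{\ell}\lambda_k\big(\Gamma(t)\big)\,dt$. *)

theory Defs
  imports "HOL-Analysis.Analysis"
begin

type_synonym state = "real^2"

datatype family = Slow | Fast

datatype construction = Forward | Backward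

datatype segment_kind = Shock | Rarefaction family

text \<open>The Jacobian is taken within \<open>D\<close>, so that state spaces with boundary are covered as well;
  on an open \<open>D\<close> it is the ordinary Jacobian matrix.\<close>

definition C1_flux :: "state set \<Rightarrow> (state \<Rightarrow> state) \<Rightarrow> (state \<Rightarrow> real^2^2) \<Rightarrow> bool" where
  "C1_flux D F J \<longleftrightarrow>
     (\<forall>U\<in>D. (F has_derivative (\<lambda>h. J U *v h)) (at U within D)) \<and> continuous_on D J"

definition eigenvalues :: "real^2^2 \<Rightarrow> real set" where
  "eigenvalues A = {x. \<exists>v. v \<noteq> 0 \<and> A *v v = x *\<^sub>R v}"

text \<open>A real \<open>2 \<times> 2\<close> matrix without real eigenvalues has an empty set \<^const>\<open>eigenvalues\<close>, so the first
  conjunct says that both eigenvalues are real; they may coincide.\<close>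

definition eigenstructure ::
  "(state \<Rightarrow> real^2^2) \<Rightarrow> (family \<Rightarrow> state \<Rightarrow> real) \<Rightarrow> (family \<Rightarrow> state \<Rightarrow> real^2) \<Rightarrow> state \<Rightarrow> bool" where
  "eigenstructure J lam r U \<longleftrightarrow>
     eigenvalues (J U) = {lam Slow U, lam Fast U} \<and> lam Slow U \<le> lam Fast U \<and>
     (\<forall>k. r k U \<noteq> 0 \<and> J U *v r k U = lam k U *\<^sub>R r k U)"

definition rankine_hugoniot :: "(state \<Rightarrow> state) \<Rightarrow> state \<Rightarrow> state \<Rightarrow> real \<Rightarrow> bool" where
  "rankine_hugoniot F R U s \<longleftrightarrow> F U - s *\<^sub>R U = F R - s *\<^sub>R R"

definition hugoniot_locus :: "state set \<Rightarrow> (state \<Rightarrow> state) \<Rightarrow> state \<Rightarrow> state set" where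
  "hugoniot_locus D F R = {U \<in> D. \<exists>s. rankine_hugoniot F R U s}"

text \<open>For \<open>U \<noteq> R\<close> this determines \<open>\<sigma> R U\<close>, whereas \<open>\<sigma> R R\<close> is left arbitrary.\<close>

definition shock_speed ::
  "state set \<Rightarrow> (state \<Rightarrow> state) \<Rightarrow> (state \<Rightarrow> state \<Rightarrow> real) \<Rightarrow> bool" where
  "shock_speed D F \<sigma> \<longleftrightarrow> (\<forall>R\<in>D. \<forall>U\<in>hugoniot_locus D F R. rankine_hugoniot F R U (\<sigma> R U))"

definition less_up_to_one_equality :: "(real \<times> real) list \<Rightarrow> bool" where
  "less_up_to_one_equality ps \<longleftrightarrow>
     (\<forall>(a, b)\<in>set ps. a \<le> b) \<and> length (filter (\<lambda>(a, b). a = b) ps) \<le> 1"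

definition slow_shock :: "(family \<Rightarrow> state \<Rightarrow> real) \<Rightarrow> state \<Rightarrow> state \<Rightarrow> real \<Rightarrow> bool" where
  "slow_shock lam UL UR s \<longleftrightarrow>
     less_up_to_one_equality [(lam Slow UR, s), (s, lam Slow UL), (s, lam Fast UR)]"

definition fast_shock :: "(family \<Rightarrow> state \<Rightarrow> real) \<Rightarrow> state \<Rightarrow> state \<Rightarrow> real \<Rightarrow> bool" where
  "fast_shock lam UL UR s \<longleftrightarrow>
     less_up_to_one_equality [(lam Fast UR, s), (s, lam Fast UL), (lam Slow UL, s)]"

definition hugoniot_arc ::
  "state set \<Rightarrow> (state \<Rightarrow> state) \<Rightarrow> state \<Rightarrow> state \<Rightarrow> (real \<Rightarrow> state) \<Rightarrow> bool" where
  "hugoniot_arc D F R U g \<longleftrightarrow>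
     arc g \<and> path_image g \<subseteq> hugoniot_locus D F R \<and> pathstart g = R \<and> pathfinish g = U"

text \<open>Liu's criterion compares the speed of the shock with the speeds along an arc of the Hugoniot
  locus between the two states. It is applicable only if there is such an arc, that is, if \<open>U\<close> does
  not lie on a branch detached from \<open>R\<close>. For a fixed left state \<open>R\<close> the shock has to be the
  slowest one on the arc, for a fixed right state \<open>R\<close> the fastest one.\<close>

definition liu ::
  "construction \<Rightarrow> state set \<Rightarrow> (state \<Rightarrow> state) \<Rightarrow> (state \<Rightarrow> state \<Rightarrow> real) \<Rightarrow> state \<Rightarrow> state \<Rightarrow> bool"
  where
  "liu c D F \<sigma> R U \<longleftrightarrow>
     (\<exists>g. hugoniot_arc D F R U g) \<longrightarrow>
     (\<exists>g. hugoniot_arc D F R U g \<and>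
        (\<forall>W \<in> path_image g - {R}.
           case c of Forward \<Rightarrow> \<sigma> R U \<le> \<sigma> R W | Backward \<Rightarrow> \<sigma> R W \<le> \<sigma> R U))"

definition admissible ::
  "construction \<Rightarrow> state set \<Rightarrow> (state \<Rightarrow> state) \<Rightarrow> (family \<Rightarrow> state \<Rightarrow> real) \<Rightarrow>
   (state \<Rightarrow> state \<Rightarrow> real) \<Rightarrow> state \<Rightarrow> state \<Rightarrow> bool" where
  "admissible c D F lam \<sigma> R U \<longleftrightarrow>
     (case c of
        Forward \<Rightarrow> slow_shock lam R U (\<sigma> R U) \<or> fast_shock lam R U (\<sigma> R U)
      | Backward \<Rightarrow> slow_shock lam U R (\<sigma> R U) \<or> fast_shock lam U R (\<sigma> R U)) \<and>
     liu c D F \<sigma> R U"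

text \<open>At \<open>U = R\<close>, where a shock segment may begin, there is no discontinuity.\<close>

definition shock_segment ::
  "construction \<Rightarrow> state set \<Rightarrow> (state \<Rightarrow> state) \<Rightarrow> (family \<Rightarrow> state \<Rightarrow> real) \<Rightarrow>
   (state \<Rightarrow> state \<Rightarrow> real) \<Rightarrow> state \<Rightarrow> (real \<Rightarrow> state) \<Rightarrow> real set \<Rightarrow> bool" where
  "shock_segment c D F lam \<sigma> R \<Gamma> T \<longleftrightarrow>
     (\<forall>l\<in>T. \<Gamma> l \<in> hugoniot_locus D F R \<and> (\<Gamma> l \<noteq> R \<longrightarrow> admissible c D F lam \<sigma> R (\<Gamma> l)))"

text \<open>\<open>\<Gamma>\<close> on the interval \<open>T\<close>, one of whose endpoints is \<open>a\<close>, is an arc beginning at \<open>\<Gamma> a\<close> of an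
  integral curve of \<open>r k\<close>. Since \<open>T\<close> may lie to the left of \<open>a\<close>, monotonicity along the arc
  refers to the distance from \<open>a\<close>.\<close>

definition rarefaction_segment ::
  "construction \<Rightarrow> (family \<Rightarrow> state \<Rightarrow> real) \<Rightarrow> (family \<Rightarrow> state \<Rightarrow> real^2) \<Rightarrow>
   family \<Rightarrow> (real \<Rightarrow> state) \<Rightarrow> real \<Rightarrow> real set \<Rightarrow> bool" where
  "rarefaction_segment c lam r k \<Gamma> a T \<longleftrightarrow>
     (\<exists>\<Gamma>'. continuous_on T \<Gamma>' \<and>
        (\<forall>l\<in>T. (\<Gamma> has_vector_derivative \<Gamma>' l) (at l within T) \<and>
               (\<exists>m. \<Gamma>' l = m *\<^sub>R r k (\<Gamma> l)))) \<and>
     (\<forall>s\<in>T. \<forall>t\<in>T. dist a s \<le> dist a t \<longrightarrow>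
        (case c of
           Forward \<Rightarrow> lam k (\<Gamma> s) \<le> lam k (\<Gamma> t)
         | Backward \<Rightarrow> lam k (\<Gamma> t) \<le> lam k (\<Gamma> s)))"

text \<open>The decomposition of a curve into consecutive segments is a list that gives for every segment
  the parameter at which it begins and its kind. A segment extends up to the beginning of the next
  one, the last segment up to the end of the curve. As the curve may be traversed in the direction
  of increasing or of decreasing parameter, the order along it is that of the distances to the
  initial parameter.\<close>

definition segment_start :: "(real \<times> segment_kind) list \<Rightarrow> nat \<Rightarrow> real" where
  "segment_start segs j = fst (segs ! j)"

definition segment_kind_at :: "(real \<times> segment_kind) list \<Rightarrow> nat \<Rightarrow> segment_kind" where
  "segment_kind_at segs j = snd (segs ! j)"

definition segment_dom :: "real set \<Rightarrow> (real \<times> segment_kind) list \<Rightarrow> nat \<Rightarrow> real set" where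
  "segment_dom I segs j =
     {l \<in> I. dist (segment_start segs 0) (segment_start segs j) \<le> dist (segment_start segs 0) l \<and>
             (Suc j < length segs \<longrightarrow>
                dist (segment_start segs 0) l
                  \<le> dist (segment_start segs 0) (segment_start segs (Suc j)))}"

text \<open>Two adjacent shock segments together form a shock segment, so that no condition is needed.\<close>

fun transition ::
  "state set \<Rightarrow> (state \<Rightarrow> state) \<Rightarrow> (family \<Rightarrow> state \<Rightarrow> real) \<Rightarrow> (state \<Rightarrow> state \<Rightarrow> real) \<Rightarrow>
   state \<Rightarrow> segment_kind \<Rightarrow> segment_kind \<Rightarrow> state \<Rightarrow> bool" where
  "transition D F lam \<sigma> R Shock (Rarefaction k) U \<longleftrightarrow> U \<in> hugoniot_locus D F R \<and> \<sigma> R U = lam k U"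
| "transition D F lam \<sigma> R (Rarefaction k) Shock U \<longleftrightarrow> U \<in> hugoniot_locus D F R \<and> \<sigma> R U = lam k U"
| "transition D F lam \<sigma> R Shock Shock U \<longleftrightarrow> True"
| "transition D F lam \<sigma> R (Rarefaction k) (Rarefaction k') U \<longleftrightarrow> False"

text \<open>\<open>\<Gamma>\<close> is a wave curve starting at \<open>R\<close>, parametrized over the interval \<open>I\<close> by the \<open>i\<close>-th state
  coordinate, with the decomposition \<open>segs\<close>.\<close>

definition wave_curve ::
  "construction \<Rightarrow> state set \<Rightarrow> (state \<Rightarrow> state) \<Rightarrow> (family \<Rightarrow> state \<Rightarrow> real) \<Rightarrow>
   (family \<Rightarrow> state \<Rightarrow> real^2) \<Rightarrow> (state \<Rightarrow> state \<Rightarrow> real) \<Rightarrow> state \<Rightarrow> 2 \<Rightarrow>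
   real set \<Rightarrow> (real \<Rightarrow> state) \<Rightarrow> (real \<times> segment_kind) list \<Rightarrow> bool" where
  "wave_curve c D F lam r \<sigma> R i I \<Gamma> segs \<longleftrightarrow>
     is_interval I \<and> R $ i \<in> I \<and> (I \<subseteq> {R $ i..} \<or> I \<subseteq> {..R $ i}) \<and>
     continuous_on I \<Gamma> \<and> \<Gamma> ` I \<subseteq> D \<and> (\<forall>l\<in>I. \<Gamma> l $ i = l) \<and> \<Gamma> (R $ i) = R \<and>
     segs \<noteq> [] \<and> segment_start segs 0 = R $ i \<and>
     (\<forall>j<length segs. segment_start segs j \<in> I) \<and>
     (\<forall>j. Suc j < length segs \<longrightarrow>
        dist (R $ i) (segment_start segs j) < dist (R $ i) (segment_start segs (Suc j)) \<and>
        transition D F lam \<sigma> R (segment_kind_at segs j) (segment_kind_at segs (Suc j))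
          (\<Gamma> (segment_start segs (Suc j)))) \<and>
     (\<forall>j<length segs. case segment_kind_at segs j of
        Shock \<Rightarrow> shock_segment c D F lam \<sigma> R \<Gamma> (segment_dom I segs j)
      | Rarefaction k \<Rightarrow>
          rarefaction_segment c lam r k \<Gamma> (segment_start segs j) (segment_dom I segs j))"

text \<open>The interval integral is oriented, as is needed for segments to the left of their starting
  parameter. Integrability is required because the integral is \<open>0\<close> by convention otherwise.\<close>

definition effective_flux ::
  "(state \<Rightarrow> state) \<Rightarrow> (family \<Rightarrow> state \<Rightarrow> real) \<Rightarrow> (state \<Rightarrow> state \<Rightarrow> real) \<Rightarrow> state \<Rightarrow> 2 \<Rightarrow>
   real set \<Rightarrow> (real \<Rightarrow> state) \<Rightarrow> (real \<times> segment_kind) list \<Rightarrow> (real \<Rightarrow> real) \<Rightarrow> bool" where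
  "effective_flux F lam \<sigma> R i I \<Gamma> segs f \<longleftrightarrow>
     (\<forall>j<length segs. \<forall>l \<in> segment_dom I segs j. case segment_kind_at segs j of
        Shock \<Rightarrow> f l = F R $ i + \<sigma> R (\<Gamma> l) * (l - R $ i)
      | Rarefaction k \<Rightarrow>
          (let a = segment_start segs j in
             interval_lebesgue_integrable lborel (ereal a) (ereal l) (\<lambda>t. lam k (\<Gamma> t)) \<and>
             f l = F (\<Gamma> a) $ i + (LBINT t=ereal a..ereal l. lam k (\<Gamma> t))))"

end

theory Submission
  imports Defs
begin

text \<open>On either kind of segment the flux component \<open>f\<^sub>i \<circ> \<Gamma>\<close> is determined by one scalar
  relation, which the normalization \<open>\<gamma>\<^sub>i(l) = l\<close> turns into the defining formula of an effective
  flux function.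

  On a shock segment this is the \<open>i\<close>-th Rankine--Hugoniot relation. All shock states
  are joined to the same state \<open>R\<close>, so the relation is a formula for the flux itself, and nothing has
  to be propagated from one segment to the next (lemma \<open>rankine_hugoniot_component\<close>).

  On a \<open>k\<close>-rarefaction segment the tangent \<open>\<Gamma>'\<close> is a multiple of the eigenvector \<open>r\<^sub>k\<close>, so the
  chain rule gives \<open>(F \<circ> \<Gamma>)' = J \<Gamma>' = \<lambda>\<^sub>k \<Gamma>'\<close> (lemma \<open>flux_derivative_along_eigenvector_curve\<close>).
  The \<open>i\<close>-th component of \<open>\<Gamma>'\<close> is \<open>1\<close>, hence \<open>(f\<^sub>i \<circ> \<Gamma>)' = \<lambda>\<^sub>k \<circ> \<Gamma>\<close>, and the
  fundamental theorem of calculus yields the integral formula (lemma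
  \<open>flux_along_eigenvector_curve\<close>). That theorem of calculus requires \<open>\<lambda>\<^sub>k \<circ> \<Gamma>\<close> to be continuous, and this
  comes from the same computation: \<open>\<lambda>\<^sub>k \<circ> \<Gamma>\<close> is the \<open>i\<close>-th component of \<open>J \<Gamma>'\<close>, in
  which both factors are continuous.\<close>

lemma rankine_hugoniot_component:
  assumes "rankine_hugoniot F R U s"
  shows "F U $ i = F R $ i + s * (U $ i - R $ i)"
proof -
  have "(F U - s *\<^sub>R U) $ i = (F R - s *\<^sub>R R) $ i"
    using assms by (simp add: rankine_hugoniot_def)
  then show ?thesis
    by (simp add: algebra_simps)
qed

text \<open>Distances to the initial parameter order the curve faithfully only because the parameter
  interval lies on one side of it; on an interval
  around it, a segment would in general consist of two separate pieces.\<close>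

lemma closed_segment_subset_segment_dom:
  assumes "is_interval I" and "I \<subseteq> {segment_start segs 0..} \<or> I \<subseteq> {..segment_start segs 0}"
    and "x \<in> segment_dom I segs j" and "y \<in> segment_dom I segs j"
  shows "closed_segment x y \<subseteq> segment_dom I segs j"
proof
  fix t assume t: "t \<in> closed_segment x y"
  have I: "x \<in> I" "y \<in> I"
    using assms(3,4) by (auto simp: segment_dom_def)
  then have "t \<in> I"
    using t assms(1) closed_segment_subset is_interval_convex_1 by blast
  with I t assms(2-4) show "t \<in> segment_dom I segs j"
    by (auto simp: segment_dom_def dist_real_def closed_segment_eq_real_ivl abs_if
        split: if_splits)
qed

lemma flux_derivative_along_eigenvector_curve:
  assumes "C1_flux D F J" and "\<Gamma> ` K \<subseteq> D" and "t \<in> K"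
    and "(\<Gamma> has_vector_derivative v) (at t within K)"
    and "v = m *\<^sub>R e" and "J (\<Gamma> t) *v e = x *\<^sub>R e"
  shows "((\<lambda>t. F (\<Gamma> t)) has_vector_derivative J (\<Gamma> t) *v v) (at t within K)"
    and "J (\<Gamma> t) *v v = x *\<^sub>R v"
proof -
  have "(F has_derivative (\<lambda>h. J (\<Gamma> t) *v h)) (at (\<Gamma> t) within \<Gamma> ` K)"
    using assms(1-3) by (auto simp: C1_flux_def intro: has_derivative_subset)
  with assms(4) show "((\<lambda>t. F (\<Gamma> t)) has_vector_derivative J (\<Gamma> t) *v v) (at t within K)"
    using vector_derivative_diff_chain_within[of \<Gamma> v t K F] by (simp add: o_def)
  show "J (\<Gamma> t) *v v = x *\<^sub>R v"
    using assms(5,6) by (simp add: matrix_vector_mult_scaleR scaleR_left_commute)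
qed

text \<open>The endpoints may come in either order, since a wave curve may run towards smaller values of
  the coordinate.\<close>

lemma flux_along_eigenvector_curve:
  fixes a b :: real
  defines "K \<equiv> closed_segment a b"
  assumes flux: "C1_flux D F J" and D: "\<Gamma> ` K \<subseteq> D"
    and coord: "\<And>t. t \<in> K \<Longrightarrow> \<Gamma> t $ i = t"
    and cont: "continuous_on K \<Gamma>'"
    and deriv: "\<And>t. t \<in> K \<Longrightarrow> (\<Gamma> has_vector_derivative \<Gamma>' t) (at t within K)"
    and tangent: "\<And>t. t \<in> K \<Longrightarrow> \<exists>m. \<Gamma>' t = m *\<^sub>R e (\<Gamma> t)"
    and eigen: "\<And>t. t \<in> K \<Longrightarrow> J (\<Gamma> t) *v e (\<Gamma> t) = x (\<Gamma> t) *\<^sub>R e (\<Gamma> t)"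
  shows "interval_lebesgue_integrable lborel (ereal a) (ereal b) (\<lambda>t. x (\<Gamma> t))"
    and "F (\<Gamma> b) $ i = F (\<Gamma> a) $ i + (LBINT t=ereal a..ereal b. x (\<Gamma> t))"
proof -
  have "interval_lebesgue_integrable lborel (ereal a) (ereal b) (\<lambda>t. x (\<Gamma> t)) \<and>
        F (\<Gamma> b) $ i = F (\<Gamma> a) $ i + (LBINT t=ereal a..ereal b. x (\<Gamma> t))"
  \<comment> \<open>On a one-point interval every vector is a derivative of \<open>\<Gamma>\<close>, so \<open>\<Gamma>' t $ i = 1\<close> can be
    concluded only if \<open>a \<noteq> b\<close>.\<close>
  proof (cases "a = b")
    case True
    then show ?thesis
      by (simp add: interval_lebesgue_integrable_def set_integrable_def)
  next
    case False
    have K: "K = {min a b..max a b}"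
      by (auto simp: K_def closed_segment_eq_real_ivl)
    have speed: "(J (\<Gamma> t) *v \<Gamma>' t) $ i = x (\<Gamma> t)" if t: "t \<in> K" for t
    proof -
      have "((\<lambda>t. \<Gamma> t $ i) has_vector_derivative \<Gamma>' t $ i) (at t within K)"
        using bounded_linear.has_vector_derivative[OF bounded_linear_vec_nth deriv[OF t]] .
      then have "((\<lambda>t. t) has_vector_derivative \<Gamma>' t $ i) (at t within K)"
        by (rule has_vector_derivative_transform[OF t, rotated]) (simp add: coord)
      moreover have "((\<lambda>t. t) has_vector_derivative (1::real)) (at t within K)"
        by (rule has_vector_derivative_id)
      ultimately have "\<Gamma>' t $ i = 1"
        using vector_derivative_unique_within_closed_interval[of "min a b" "max a b" t] False t K
        by (metis box_real(2) max_def min_def order_less_le linorder_le_cases)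
      then show ?thesis
        using flux_derivative_along_eigenvector_curve(2)[OF flux D t deriv[OF t] _ eigen[OF t]]
          tangent[OF t] by auto
    qed
    have deriv_flux: "((\<lambda>t. F (\<Gamma> t) $ i) has_vector_derivative x (\<Gamma> t)) (at t within K)"
      if t: "t \<in> K" for t
    proof -
      have "((\<lambda>t. F (\<Gamma> t)) has_vector_derivative J (\<Gamma> t) *v \<Gamma>' t) (at t within K)"
        using flux_derivative_along_eigenvector_curve(1)[OF flux D t deriv[OF t] _ eigen[OF t]]
          tangent[OF t] by blast
      then show ?thesis
        unfolding speed[OF t, symmetric]
        by (rule bounded_linear.has_vector_derivative[OF bounded_linear_vec_nth])
    qed
    have "continuous_on K \<Gamma>"
      using has_vector_derivative_continuous[OF deriv] by (auto simp: continuous_on_eq_continuous_within)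
    moreover have "continuous_on D J"
      using flux by (simp add: C1_flux_def)
    ultimately have "continuous_on K (\<lambda>t. J (\<Gamma> t))"
      using D continuous_on_compose2 by blast
    then have "continuous_on K (\<lambda>t. (J (\<Gamma> t) *v \<Gamma>' t) $ i)"
      unfolding matrix_vector_mult_def using cont by (auto intro!: continuous_intros)
    then have cont_speed: "continuous_on K (\<lambda>t. x (\<Gamma> t))"
      by (simp add: speed cong: continuous_on_cong)
    have "interval_lebesgue_integrable lborel (ereal a) (ereal b) (\<lambda>t. x (\<Gamma> t))"
    proof (cases "a \<le> b")
      case True
      with cont_speed K show ?thesis
        by (intro interval_integrable_continuous_on) auto
    next
      case False
      with cont_speed K show ?thesis
        by (subst interval_integrable_endpoints_reverse)
           (intro interval_integrable_continuous_on, auto)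
    qed
    moreover have "(LBINT t=ereal a..ereal b. x (\<Gamma> t)) = F (\<Gamma> b) $ i - F (\<Gamma> a) $ i"
      using cont_speed deriv_flux unfolding K
      by (intro interval_integral_FTC_finite) auto
    ultimately show ?thesis
      by simp
  qed
  then show "interval_lebesgue_integrable lborel (ereal a) (ereal b) (\<lambda>t. x (\<Gamma> t))"
    and "F (\<Gamma> b) $ i = F (\<Gamma> a) $ i + (LBINT t=ereal a..ereal b. x (\<Gamma> t))"
    by auto
qed

theorem theorem1:
  fixes D :: "state set" and F :: "state \<Rightarrow> state" and J :: "state \<Rightarrow> real^2^2"
    and lam :: "family \<Rightarrow> state \<Rightarrow> real" and r :: "family \<Rightarrow> state \<Rightarrow> real^2"
    and \<sigma> :: "state \<Rightarrow> state \<Rightarrow> real" and c :: construction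
    and R :: state and i :: 2 and I :: "real set" and \<Gamma> :: "real \<Rightarrow> state"
    and segs :: "(real \<times> segment_kind) list"
  assumes "C1_flux D F J"
    and "shock_speed D F \<sigma>"
    and "\<forall>U \<in> \<Gamma> ` I. eigenstructure J lam r U"
    and "wave_curve c D F lam r \<sigma> R i I \<Gamma> segs"
  shows "effective_flux F lam \<sigma> R i I \<Gamma> segs (\<lambda>l. F (\<Gamma> l) $ i)"
  unfolding effective_flux_def
proof (intro allI impI ballI)
  fix j l
  assume j: "j < length segs" and l: "l \<in> segment_dom I segs j"
  define a where "a = segment_start segs j"
  define T where "T = segment_dom I segs j"
  from assms(4) have I: "is_interval I"
      "I \<subseteq> {segment_start segs 0..} \<or> I \<subseteq> {..segment_start segs 0}"
    and RI: "R $ i \<in> I" "\<Gamma> (R $ i) = R" and D: "\<Gamma> ` I \<subseteq> D"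
    and coord: "\<forall>l\<in>I. \<Gamma> l $ i = l" and start: "segment_start segs 0 = R $ i"
    and aI: "a \<in> I"
    and step: "Suc j < length segs \<Longrightarrow> dist (R $ i) a < dist (R $ i) (segment_start segs (Suc j))"
    and seg: "case segment_kind_at segs j of
        Shock \<Rightarrow> shock_segment c D F lam \<sigma> R \<Gamma> T
      | Rarefaction k \<Rightarrow> rarefaction_segment c lam r k \<Gamma> a T"
    using j unfolding wave_curve_def a_def T_def by auto
  have TI: "T \<subseteq> I"
    by (auto simp: T_def segment_dom_def)
  show "case segment_kind_at segs j of
        Shock \<Rightarrow> F (\<Gamma> l) $ i = F R $ i + \<sigma> R (\<Gamma> l) * (l - R $ i)
      | Rarefaction k \<Rightarrow>
          (let a = segment_start segs j in
             interval_lebesgue_integrable lborel (ereal a) (ereal l) (\<lambda>t. lam k (\<Gamma> t)) \<and>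
             F (\<Gamma> l) $ i = F (\<Gamma> a) $ i + (LBINT t=ereal a..ereal l. lam k (\<Gamma> t)))"
  proof (cases "segment_kind_at segs j")
    case Shock
    with seg l have "\<Gamma> l \<in> hugoniot_locus D F R"
      by (auto simp: shock_segment_def T_def)
    moreover have "R \<in> D"
      using RI D by (metis image_subset_iff)
    ultimately have "rankine_hugoniot F R (\<Gamma> l) (\<sigma> R (\<Gamma> l))"
      using assms(2) by (auto simp: shock_speed_def)
    from rankine_hugoniot_component[OF this, of i] show ?thesis
      using Shock coord TI l by (auto simp: T_def)
  next
    case (Rarefaction k)
    with seg obtain \<Gamma>' where \<Gamma>': "continuous_on T \<Gamma>'"
      "\<And>t. t \<in> T \<Longrightarrow> (\<Gamma> has_vector_derivative \<Gamma>' t) (at t within T)"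
      "\<And>t. t \<in> T \<Longrightarrow> \<exists>m. \<Gamma>' t = m *\<^sub>R r k (\<Gamma> t)"
      by (auto simp: rarefaction_segment_def)
    \<comment> \<open>The segments are ordered along the curve, so this one begins before its successor does.\<close>
    have "a \<in> T"
      using aI step by (auto simp: T_def segment_dom_def start a_def[symmetric])
    then have K: "closed_segment a l \<subseteq> T"
      using closed_segment_subset_segment_dom[OF I] l by (auto simp: T_def)
    have eigen: "J (\<Gamma> t) *v r k (\<Gamma> t) = lam k (\<Gamma> t) *\<^sub>R r k (\<Gamma> t)" if "t \<in> T" for t
      using assms(3) that TI by (auto simp: eigenstructure_def)
    have "\<Gamma> ` closed_segment a l \<subseteq> D"
      using D K TI by blast
    note formula = flux_along_eigenvector_curve[where e = "r k" and x = "lam k" and \<Gamma>' = \<Gamma>',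
        OF assms(1) this]
    have "interval_lebesgue_integrable lborel (ereal a) (ereal l) (\<lambda>t. lam k (\<Gamma> t)) \<and>
        F (\<Gamma> l) $ i = F (\<Gamma> a) $ i + (LBINT t=ereal a..ereal l. lam k (\<Gamma> t))"
      using K TI coord eigen \<Gamma>'(3)
      by (intro conjI formula continuous_on_subset[OF \<Gamma>'(1)]
          has_vector_derivative_within_subset[OF \<Gamma>'(2)]) blast+
    then show ?thesis
      by (simp add: Rarefaction a_def)
  qed
qed

end
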